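(* Let $a \in \mathbb{N}=\{0,1,2,\dots\}$ and let $s \in \mathbb{C}$ with $\operatorname{Re}(s) > a+2$. Then for every real $x \geq 0$, $$ \sum_{k \geq 1} (k + x)^a\,\zeta(s, k + x) = -\frac{1}{a + 1} B_{a + 1}(x + 1)\, \zeta(s, x+1) + \frac{1}{a + 1}\sum_{j=0}^{a+1} \binom{a + 1}{j} B_j\, \zeta(s-a+j-1,x+1). $$
   Context: $\zeta(s,x) = \sum_{n\ge 0} (n+x)^{-s}$ denotes the Hurwitz zeta function (for $\operatorname{Re}(s)>1$, $x>0$). $B_n(x)$ denotes the $n$th Bernoulli polynomial (generating function $t e^{xt}/(e^t-1)=\sum_n B_n(x)t^n/n!$), and $B_n$ denotes the $n$th Bernoulli number with the convention $B_1 = +\tfrac12$, i.e. $B_n = B_n(1)$ (so $B_0=1$, $B_1=\tfrac12$, $B_2=\tfrac16,\dots$). *)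

theory Defs
  imports "HOL-Analysis.Analysis" "HOL-Computational_Algebra.Formal_Power_Series"
begin

definition hurwitz_zeta :: "complex \<Rightarrow> real \<Rightarrow> complex" where
  "hurwitz_zeta s x = (\<Sum>n. complex_of_real (real n + x) powr (-s))"

text \<open>
  The function \<open>B\<^sub>n(x)\<close>, read off from the exponential generating function
  \<open>t e\<^bsup>xt\<^esup> / (e\<^bsup>t\<^esup> - 1)\<close>. Numerator and denominator both have subdegree 1,
  so the division of formal power series is exact, as \<open>bernpoly_gf\<close> confirms.
\<close>
definition bernpoly :: "nat \<Rightarrow> 'a :: field_char_0 \<Rightarrow> 'a" where
  "bernpoly n x = fact n * fps_nth (fps_X * fps_exp x / (fps_exp 1 - 1)) n"

text \<open>Convention \<open>B\<^sub>1 = 1/2\<close>.\<close>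
definition bernoulli :: "nat \<Rightarrow> 'a :: field_char_0" where
  "bernoulli n = bernpoly n 1"

lemma bernpoly_gf:
  fixes x :: "'a :: field_char_0"
  shows "Abs_fps (\<lambda>n. bernpoly n x / fact n) * (fps_exp 1 - 1) = fps_X * fps_exp x"
proof -
  have nz: "fps_exp (1::'a) - 1 \<noteq> 0"
    by (metis fps_exp_0 fps_exp_eq_iff right_minus_eq zero_neq_one)
  have sd: "subdegree (fps_exp (1::'a) - 1) \<le> subdegree (fps_X * fps_exp x)"
  proof -
    have "subdegree (fps_exp (1::'a) - 1) = 1"
      by (rule subdegreeI) auto
    moreover have "subdegree (fps_X * fps_exp x) = 1"
      by (rule subdegreeI) auto
    ultimately show ?thesis by simp
  qed
  have "Abs_fps (\<lambda>n. bernpoly n x / fact n) = fps_X * fps_exp x / (fps_exp 1 - 1)"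
    by (rule fps_ext) (simp add: bernpoly_def)
  moreover have "fps_exp (1::'a) - 1 dvd fps_X * fps_exp x"
    using nz sd by (subst fps_dvd_iff) auto
  ultimately show ?thesis by simp
qed

end

theory Submission
  imports Defs
begin

text \<open>
  Writing out the Hurwitz zeta function turns the left-hand side into an absolutely convergent
  double series over the pairs \<open>k \<le> m\<close>. Summing over \<open>k\<close> first gives the finite power sums
  \<open>\<Sum>k\<le>m. (k + 1 + x)\<^sup>a\<close>, which telescope through \<open>B\<^bsub>a+1\<^esub>(y + 1) - B\<^bsub>a+1\<^esub>(y) = (a + 1) y\<^sup>a\<close>;
  expanding \<open>B\<^bsub>a+1\<^esub>(y + 1)\<close> in powers of \<open>y = m + 1 + x\<close> then yields the zeta values
  on the right-hand side.
\<close>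

text \<open>Formal power series over a field form an integral domain. Hence identities between
  Bernoulli generating functions may be checked after multiplying by the denominator
  \<open>fps_exp 1 - 1\<close>, where \<open>bernpoly_gf\<close> applies.\<close>

lemma fps_exp_minus_1_cancel:
  fixes F G :: "'a :: field_char_0 fps"
  assumes "F * (fps_exp 1 - 1) = G * (fps_exp 1 - 1)"
  shows "F = G"
proof -
  have "fps_exp (1::'a) - 1 \<noteq> 0"
    by (metis fps_exp_0 fps_exp_eq_iff right_minus_eq zero_neq_one)
  with assms show ?thesis by simp
qed

text \<open>Multiplying the generating function at \<open>x\<close> by \<open>fps_exp y\<close>
  gives the one at \<open>x + y\<close>; the claim compares coefficients.\<close>

lemma bernpoly_add:
  fixes x y :: "'a :: field_char_0"
  shows "bernpoly n (x + y) = (\<Sum>j=0..n. of_nat (n choose j) * bernpoly j x * y ^ (n - j))"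
proof -
  have "Abs_fps (\<lambda>n. bernpoly n (x + y) / fact n) * (fps_exp 1 - 1) = fps_X * fps_exp (x + y)"
    by (rule bernpoly_gf)
  also have "\<dots> = fps_X * fps_exp x * fps_exp y"
    by (simp add: fps_exp_add_mult mult.assoc)
  also have "\<dots> = Abs_fps (\<lambda>n. bernpoly n x / fact n) * (fps_exp 1 - 1) * fps_exp y"
    by (simp add: bernpoly_gf)
  also have "\<dots> = Abs_fps (\<lambda>n. bernpoly n x / fact n) * fps_exp y * (fps_exp 1 - 1)"
    by (simp only: mult_ac)
  finally have "Abs_fps (\<lambda>n. bernpoly n (x + y) / fact n) =
      Abs_fps (\<lambda>n. bernpoly n x / fact n) * fps_exp y"
    by (rule fps_exp_minus_1_cancel)
  from arg_cong[OF this, of "\<lambda>F. fps_nth F n"]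
  have "bernpoly n (x + y) / fact n =
      (\<Sum>j=0..n. bernpoly j x / fact j * (y ^ (n - j) / fact (n - j)))"
    by (simp add: fps_mult_nth)
  hence "bernpoly n (x + y) =
      fact n * (\<Sum>j=0..n. bernpoly j x / fact j * (y ^ (n - j) / fact (n - j)))"
    by (simp add: field_simps)
  also have "\<dots> = (\<Sum>j=0..n. of_nat (n choose j) * bernpoly j x * y ^ (n - j))"
    unfolding sum_distrib_left
    by (intro sum.cong refl) (simp add: binomial_fact field_simps)
  finally show ?thesis .
qed

text \<open>Since t e^((x+1)t) - t e^(xt) = t e^(xt) (e^t - 1), the denominator cancels in the
  difference of the generating functions and only t e^(xt) is left.\<close>

lemma bernpoly_Suc_plus_1:
  fixes x :: "'a :: field_char_0"
  shows "bernpoly (Suc n) (x + 1) - bernpoly (Suc n) x = of_nat (Suc n) * x ^ n"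
proof -
  have "(Abs_fps (\<lambda>n. bernpoly n (x + 1) / fact n) - Abs_fps (\<lambda>n. bernpoly n x / fact n)) *
      (fps_exp 1 - 1) = fps_X * fps_exp x * (fps_exp 1 - 1)"
    unfolding left_diff_distrib[of "Abs_fps _"] bernpoly_gf fps_exp_add_mult
    by (simp only: right_diff_distrib mult.assoc mult_1_right)
  hence "Abs_fps (\<lambda>n. bernpoly n (x + 1) / fact n) - Abs_fps (\<lambda>n. bernpoly n x / fact n) =
      fps_X * fps_exp x"
    by (rule fps_exp_minus_1_cancel)
  from arg_cong[OF this, of "\<lambda>F. fps_nth F (Suc n)"]
  have "(bernpoly (Suc n) (x + 1) - bernpoly (Suc n) x) / fact (Suc n) = x ^ n / fact n"
    by (simp add: diff_divide_distrib)
  hence "bernpoly (Suc n) (x + 1) - bernpoly (Suc n) x = x ^ n / fact n * fact (Suc n)"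
    by (metis fact_nonzero nonzero_divide_eq_eq)
  thus ?thesis
    by (simp add: mult.commute)
qed

lemma power_sum_bernpoly:
  fixes x :: "'a :: field_char_0"
  shows "of_nat (Suc a) * (\<Sum>k\<le>m. (of_nat k + x) ^ a) =
      bernpoly (Suc a) (of_nat m + x + 1) - bernpoly (Suc a) x"
proof (induction m)
  case 0
  show ?case using bernpoly_Suc_plus_1[of a x] by simp
next
  case (Suc m)
  show ?case
    using bernpoly_Suc_plus_1[of a "of_nat (Suc m) + x"] Suc
    by (simp add: distrib_left add_ac del: of_nat_Suc) (simp add: algebra_simps)
qed

text \<open>Links the real \<open>bernpoly\<close> of the final formula with the complex one in the
  power sums: embedding the coefficients of \<open>bernpoly_gf\<close> gives the equation that
  characterises the complex generating function.\<close>

lemma of_real_bernpoly: "complex_of_real (bernpoly n x) = bernpoly n (complex_of_real x)"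
proof -
  have "Abs_fps (\<lambda>n. complex_of_real (bernpoly n x) / fact n) * (fps_exp 1 - 1) =
      fps_X * fps_exp (complex_of_real x)"
  proof (rule fps_ext)
    fix n
    have "complex_of_real
        (fps_nth (Abs_fps (\<lambda>n. bernpoly n x / fact n) * (fps_exp 1 - 1)) n) =
        complex_of_real (fps_nth (fps_X * fps_exp x) n)"
      by (simp only: bernpoly_gf)
    thus "fps_nth (Abs_fps (\<lambda>n. complex_of_real (bernpoly n x) / fact n) * (fps_exp 1 - 1)) n =
        fps_nth (fps_X * fps_exp (complex_of_real x)) n"
      by (simp add: fps_mult_nth if_distrib[of complex_of_real] cong: if_cong)
  qed
  also have "\<dots> = Abs_fps (\<lambda>n. bernpoly n (complex_of_real x) / fact n) * (fps_exp 1 - 1)"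
    by (simp only: bernpoly_gf)
  finally have "Abs_fps (\<lambda>n. complex_of_real (bernpoly n x) / fact n) =
      Abs_fps (\<lambda>n. bernpoly n (complex_of_real x) / fact n)"
    by (rule fps_exp_minus_1_cancel)
  from arg_cong[OF this, of "\<lambda>F. fps_nth F n"] show ?thesis
    by simp
qed

text \<open>Comparison with the p-series: the base is at least \<open>Suc n\<close> and the exponent
  is negative.\<close>

lemma summable_real_powr_shift:
  assumes "p < -1" "x \<ge> 0"
  shows "summable (\<lambda>n. (real n + (x + 1)) powr p)"
proof (rule summable_comparison_test')
  have "summable (\<lambda>n. real n powr p)"
    using assms(1) by (simp add: summable_real_powr_iff)
  thus "summable (\<lambda>n. real (Suc n) powr p)"
    by (rule iffD2[OF summable_Suc_iff])
  show "norm ((real n + (x + 1)) powr p) \<le> real (Suc n) powr p" if "n \<ge> 0" for n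
    using assms by (auto intro!: powr_mono2')
qed

lemma norm_powr_shift:
  assumes "x \<ge> 0"
  shows "norm (complex_of_real (real n + (x + 1)) powr s) = (real n + (x + 1)) powr Re s"
  using assms by (subst norm_powr_real_powr) (auto simp del: of_real_add)

lemma hurwitz_zeta_sums:
  assumes "Re s > 1" "x \<ge> 0"
  shows "(\<lambda>n. complex_of_real (real n + (x + 1)) powr (-s)) sums hurwitz_zeta s (x + 1)"
proof -
  have "summable (\<lambda>n. complex_of_real (real n + (x + 1)) powr (-s))"
    by (rule summable_norm_cancel, subst norm_powr_shift)
       (use assms in \<open>auto intro: summable_real_powr_shift\<close>)
  thus ?thesis
    unfolding hurwitz_zeta_def by (rule summable_sums)
qed

text \<open>Fubini on the triangle k <= m: the series in \<open>S\<close> adds up rows of fixed m,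
  the conclusion adds up columns of fixed k, where m = n + k. The first assumption is absolute
  summability over the triangle.\<close>

lemma sums_tails_swap:
  fixes f g :: "nat \<Rightarrow> complex"
  assumes "summable (\<lambda>m. norm (f m) * (\<Sum>k\<le>m. norm (g k)))"
    and summable_f: "summable (\<lambda>n. norm (f n))"
    and S: "(\<lambda>m. f m * (\<Sum>k\<le>m. g k)) sums S"
  shows "(\<lambda>k. g k * (\<Sum>n. f (n + k))) sums S"
proof -
  let ?A = "Sigma (UNIV :: nat set) (\<lambda>m. {..m})"
  let ?h = "\<lambda>(m, k). f m * g k"
  have abs: "(\<lambda>p. norm (?h p)) summable_on ?A"
  proof (subst Infinite_Sum.abs_summable_on_Sigma_iff, intro conjI ballI)
    show "(\<lambda>k. norm (?h (m, k))) summable_on {..m}" for m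
      by (intro summable_on_finite) auto
    have "norm (\<Sum>\<^sub>\<infinity>k\<in>{..m}. norm (?h (m, k))) = norm (f m) * (\<Sum>k\<le>m. norm (g k))" for m
      by (simp add: norm_mult sum_distrib_left abs_of_nonneg sum_nonneg)
    thus "(\<lambda>m. norm (\<Sum>\<^sub>\<infinity>k\<in>{..m}. norm (?h (m, k)))) summable_on UNIV"
      using assms(1) by (subst summable_on_UNIV_nonneg_real_iff) (simp_all add: sum_nonneg)
  qed
  have "(?h has_sum infsum ?h ?A) ?A"
    using abs_summable_summable[OF abs] by (rule has_sum_infsum)
  have row: "((\<lambda>k. ?h (m, k)) has_sum f m * (\<Sum>k\<le>m. g k)) {..m}" for m
    by (rule has_sum_finiteI) (auto simp: sum_distrib_left)
  have "((\<lambda>m. f m * (\<Sum>k\<le>m. g k)) has_sum infsum ?h ?A) UNIV"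
    by (rule has_sum_SigmaD[OF \<open>(?h has_sum infsum ?h ?A) ?A\<close> row])
  \<comment> \<open>The unordered sum over the triangle is also the ordered sum of its rows, so
    uniqueness of limits identifies it with \<open>S\<close>.\<close>
  hence "infsum ?h ?A = S"
    using S has_sum_imp_sums sums_unique2 by blast
  with \<open>(?h has_sum infsum ?h ?A) ?A\<close> have *: "(?h has_sum S) ?A"
    by simp
  \<comment> \<open>The substitution n = m - k turns the triangle into the full quadrant.\<close>
  have "((\<lambda>(k, n). f (n + k) * g k) has_sum S) (Sigma UNIV (\<lambda>_. UNIV)) \<longleftrightarrow> (?h has_sum S) ?A"
    by (rule has_sum_reindex_bij_witness[of _
          "\<lambda>(m, k). (k, m - k)" "\<lambda>(k, n). (n + k, k)"]) auto
  with * have "((\<lambda>(k, n). f (n + k) * g k) has_sum S) (Sigma UNIV (\<lambda>_. UNIV))"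
    by (rule iffD2[rotated])
  moreover have "((\<lambda>n. (\<lambda>(k, n). f (n + k) * g k) (k, n))
      has_sum (g k * (\<Sum>n. f (n + k)))) UNIV" for k
  proof -
    have s: "summable (\<lambda>n. norm (f (n + k)))"
      using summable_f by (rule summable_ignore_initial_segment)
    have "((\<lambda>n. f (n + k)) has_sum (\<Sum>n. f (n + k))) UNIV"
      by (rule norm_summable_imp_has_sum[OF s summable_sums[OF summable_norm_cancel[OF s]]])
    from has_sum_cmult_left[OF this, of "g k"] show ?thesis by (simp add: mult.commute)
  qed
  ultimately have "((\<lambda>k. g k * (\<Sum>n. f (n + k))) has_sum S) UNIV"
    by (rule has_sum_SigmaD)
  thus ?thesis by (rule has_sum_imp_sums)
qed

theorem theorem1p7:
  fixes a :: nat and s :: complex and x :: real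
  assumes "Re s > real a + 2" and "x \<ge> 0"
  shows "(\<lambda>k. complex_of_real ((real (Suc k) + x) ^ a) * hurwitz_zeta s (real (Suc k) + x)) sums
    (- (1 / (of_nat a + 1)) * complex_of_real (bernpoly (a + 1) (x + 1)) * hurwitz_zeta s (x + 1)
     + 1 / (of_nat a + 1) *
       (\<Sum>j = 0..a + 1. of_nat ((a + 1) choose j) * bernoulli j
          * hurwitz_zeta (s - of_nat a + of_nat j - 1) (x + 1)))"
    (is "_ sums ?S")
proof -
  define y :: "nat \<Rightarrow> real" where "y = (\<lambda>n. real n + (x + 1))"
  define f where "f = (\<lambda>m. complex_of_real (y m) powr (-s))"
  define g where "g = (\<lambda>k. complex_of_real (y k ^ a))"
  have y_pos: "y n > 0" for n
    using assms by (simp add: y_def)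
  have norm_f: "norm (f m) = y m powr (- Re s)" for m
    using norm_powr_shift[OF assms(2), of m "-s"] by (simp add: f_def y_def)
  have summable_f: "summable (\<lambda>m. norm (f m))"
    unfolding norm_f y_def by (rule summable_real_powr_shift) (use assms in auto)
  \<comment> \<open>Each of the m + 1 terms is at most \<open>y m ^ a\<close>, and m + 1 <=
    \<open>y m\<close> because x >= 0. The resulting exponent is below -1 exactly because Re s > a +
    2.\<close>
  have bound: "norm (f m) * (\<Sum>k\<le>m. norm (g k)) \<le> y m powr (real a + 1 - Re s)" for m
  proof -
    have "(\<Sum>k\<le>m. norm (g k)) \<le> (\<Sum>k\<le>m. y m ^ a)"
      using assms y_pos
      by (intro sum_mono) (auto simp: g_def norm_power y_def less_imp_le simp del: of_real_add
            intro!: power_mono)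
    also have "\<dots> = real (Suc m) * y m ^ a"
      by simp
    also have "\<dots> \<le> y m * y m ^ a"
      using assms y_pos[of m] by (intro mult_right_mono) (auto simp: y_def)
    also have "\<dots> = y m powr (real a + 1)"
      using y_pos[of m] powr_realpow[of "y m" "Suc a"] by (simp add: add.commute)
    finally have "norm (f m) * (\<Sum>k\<le>m. norm (g k)) \<le> y m powr (- Re s) * y m powr (real a + 1)"
      unfolding norm_f by (intro mult_left_mono) auto
    thus ?thesis
      by (simp add: powr_add[symmetric] algebra_simps)
  qed
  have summable_y: "summable (\<lambda>m. y m powr (real a + 1 - Re s))"
    unfolding y_def by (rule summable_real_powr_shift) (use assms in auto)
  have "(\<lambda>k. g k * (\<Sum>n. f (n + k))) sums ?S"
  proof (rule sums_tails_swap)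
    show "summable (\<lambda>m. norm (f m) * (\<Sum>k\<le>m. norm (g k)))"
      by (rule summable_comparison_test'[OF summable_y])
         (use bound in \<open>auto simp: abs_mult abs_of_nonneg sum_nonneg\<close>)
    show "summable (\<lambda>m. norm (f m))"
      by (rule summable_f)
    have split: "f m * (\<Sum>k\<le>m. g k) =
        - (1 / (of_nat a + 1)) * complex_of_real (bernpoly (a + 1) (x + 1)) * f m
        + 1 / (of_nat a + 1) * (\<Sum>j = 0..a + 1. of_nat ((a + 1) choose j) * bernoulli j
            * complex_of_real (y m) powr (- (s - of_nat a + of_nat j - 1)))" for m
    proof -
      let ?Y = "complex_of_real (y m)"
      have nz: "(of_nat a + 1 :: complex) \<noteq> 0"
        by (metis of_nat_Suc of_nat_neq_0 add.commute)
      have "(of_nat a + 1) * (\<Sum>k\<le>m. g k) =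
          bernpoly (a + 1) (1 + ?Y) - complex_of_real (bernpoly (a + 1) (x + 1))"
        using power_sum_bernpoly[where m = m and a = a and x = "complex_of_real (x + 1)"]
        by (simp add: g_def y_def of_real_bernpoly add_ac)
      \<comment> \<open>Expanding around 1 rather than 0 produces the values B_j(1), hence the
        convention B_1 = 1/2.\<close>
      also have "bernpoly (a + 1) (1 + ?Y) =
          (\<Sum>j = 0..a + 1. of_nat ((a + 1) choose j) * bernoulli j * ?Y ^ (a + 1 - j))"
        by (simp only: bernpoly_add bernoulli_def)
      finally have power_sum: "(\<Sum>k\<le>m. g k) = 1 / (of_nat a + 1) *
          ((\<Sum>j = 0..a + 1. of_nat ((a + 1) choose j) * bernoulli j * ?Y ^ (a + 1 - j))
           - complex_of_real (bernpoly (a + 1) (x + 1)))"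
        using nz by (simp add: field_simps)
      have expand: "f m * (\<Sum>j = 0..a + 1. of_nat ((a + 1) choose j) * bernoulli j * ?Y ^ (a + 1 - j))
          = (\<Sum>j = 0..a + 1. of_nat ((a + 1) choose j) * bernoulli j
            * ?Y powr (- (s - of_nat a + of_nat j - 1)))"
        unfolding sum_distrib_left
      proof (intro sum.cong refl)
        fix j assume "j \<in> {0..a + 1}"
        hence *: "- (s - of_nat a + of_nat j - 1) = -s + of_nat (a + 1 - j)"
          by (simp add: of_nat_diff)
        \<comment> \<open>For j = a + 1 the natural exponent is 0, and \<open>powr\<close> agrees
          with the power there only because \<open>?Y\<close> is nonzero.\<close>
        have "?Y powr (-s + of_nat (a + 1 - j)) = f m * ?Y ^ (a + 1 - j)"
          using y_pos[of m] by (simp only: powr_add f_def powr_nat') auto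
        thus "f m * (of_nat ((a + 1) choose j) * bernoulli j * ?Y ^ (a + 1 - j)) =
            of_nat ((a + 1) choose j) * bernoulli j * ?Y powr (- (s - of_nat a + of_nat j - 1))"
          unfolding * by (simp only: mult.left_commute)
      qed
      have distrib: "u * (c * (P - b)) = - c * b * u + c * (u * P)" for u c P b :: complex
        by (simp add: algebra_simps)
      show ?thesis
        unfolding power_sum expand[symmetric] by (rule distrib)
    qed
    show "(\<lambda>m. f m * (\<Sum>k\<le>m. g k)) sums ?S"
      \<comment> \<open>Each summand is now a constant times the m-th term of a zeta series. The
        critical argument is at j = 0, with real part Re s - a - 1 > 1.\<close>
      unfolding split unfolding f_def y_def
      by (intro sums_add sums_mult sums_sum hurwitz_zeta_sums) (use assms in auto)
  qed
  \<comment> \<open>Dropping the first k terms of the series for zeta(s, x + 1) shifts its second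
    argument by k.\<close>
  moreover have "(\<Sum>n. f (n + k)) = hurwitz_zeta s (real (Suc k) + x)" for k
    by (simp add: hurwitz_zeta_def f_def y_def add_ac)
  moreover have "g k = complex_of_real ((real (Suc k) + x) ^ a)" for k
    by (simp add: g_def y_def add_ac)
  ultimately show ?thesis
    by (simp only:)
qed

end
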